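(* Let $H(x,q)=\sum_{n\ge1}x^n\sum_{w\in\mathcal{M}_n}q^{\mathrm{inter}(w)}$ be the generating function for the number of nonempty Motzkin polyominoes according to the length and the number of interior points. Then $$H(x,q)=\frac{\displaystyle\sum_{j\geq1}x^j\prod_{i=1}^{j-1}\left(q^{i-1}-\frac{1}{1-q^i}\right)} {1-\displaystyle\sum_{j\geq1}\frac{x^j}{1-q^j}\prod_{i=1}^{j-1}\left(q^{i-1}-\frac{1}{1-q^i}\right)}.$$
   Context: A Motzkin word of length $n\ge 1$ is a word $w=w_1\cdots w_n$ over the positive integers such that $w_1=1$, and $1\le w_k\le w_{k-1}+1$ and $w_{k-1}\ne w_k$ for $k=2,\dots,n$; $\mathcal{M}_n$ is the set of Motzkin words of length $n$. To $w$ one associates the Motzkin polyomino $P(w)$ of length $n$ with $n$ columns, all bottom-justified, whose $i$-th column consists of $w_i$ unit cells. An interior point of $P(w)$ is a point that belongs to exactly four cells of $P(w)$, and $\mathrm{inter}(w)$ is the number of interior points of $P(w)$. The identity is between formal power series in $x$ and $q$ (each $1/(1-q^i)$ expanded as a geometric series). *)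

theory Defs
  imports "HOL-Computational_Algebra.Formal_Power_Series"
begin

text \<open>Letters are indexed from 0, so \<open>w ! (k - 1)\<close> is the letter $w_k$.\<close>

definition motzkin_words :: "nat \<Rightarrow> nat list set" where
  "motzkin_words n =
     {w. length w = n \<and> n \<ge> 1 \<and> (\<forall>k<n. w ! k \<ge> 1) \<and> w ! 0 = 1 \<and>
         (\<forall>k\<in>{1..<n}. w ! k \<le> w ! (k - 1) + 1 \<and> w ! (k - 1) \<noteq> w ! k)}"

text \<open>Cells are closed unit squares, so that neighbouring cells share their boundary points and
  a point of the plane can belong to several cells.\<close>

definition unit_cell :: "nat \<Rightarrow> nat \<Rightarrow> (real \<times> real) set" where
  "unit_cell i j = {real i..real i + 1} \<times> {real j..real j + 1}"

definition polyomino :: "nat list \<Rightarrow> (real \<times> real) set set" where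
  "polyomino w = {unit_cell i j | i j. i < length w \<and> j < w ! i}"

definition interior_points :: "nat list \<Rightarrow> (real \<times> real) set" where
  "interior_points w = {p. card {c \<in> polyomino w. p \<in> c} = 4}"

definition inter :: "nat list \<Rightarrow> nat" where
  "inter w = card (interior_points w)"

text \<open>The ring of formal power series in $x$ and $q$ is rendered as \<open>rat fps fps\<close>: the outer
  variable is $x$, the inner one is $q$.\<close>

definition H :: "rat fps fps" where
  "H = Abs_fps (\<lambda>n. if n \<ge> 1 then \<Sum>w\<in>motzkin_words n. fps_X ^ inter w else 0)"

end

theory Submission
  imports Defs
begin

text \<open>
  Words are built by appending letters, with a catalytic variable for the last letter. The columns
  \<open>k - 1\<close> and \<open>k\<close> share a vertical segment of length \<open>min (w ! (k - 1)) (w ! k)\<close>, and the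
  interior points are the lattice points strictly inside these segments. So appending a letter \<open>a\<close>
  to \<open>w\<close> adds \<open>min (last w) a - 1\<close> interior points (lemma \<open>inter_snoc\<close>), and the letter \<open>a\<close> is
  either \<open>last w + 1\<close> or an arbitrary positive letter below \<open>last w\<close>.

  To make this a recursion, one has to keep track of the last letter. Let $b_{n,j}$ be the sum of
  $q^{\mathrm{inter}(w) + j (\mathrm{last}(w) - 1)}$ over the words \<open>w\<close> of length \<open>n\<close>, which is the
  value at $u = q^j$ of the sum with the catalytic variable \<open>u\<close> marking the last letter minus
  \<open>1\<close>. The ascent and the geometric sum over the descents give (lemma \<open>last_letter_sum_Suc\<close>)
  $$b_{n+1,j} = \frac{b_{n,0}}{1-q^{j+1}} + \Bigl(q^{j} - \frac{1}{1-q^{j+1}}\Bigr) b_{n,j+1}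
    \qquad (n \ge 1)$$
  with $b_{1,j} = 1$, so a step shifts \<open>u\<close> to \<open>qu\<close>. Unrolling from \<open>j = 0\<close> produces
  the product of the factors $q^{i-1} - 1/(1-q^i)$ (lemma \<open>unroll_shift_recurrence\<close>) and expresses $b_{n,0}$, the coefficient
  of $x^n$ in \<open>H\<close>, through the $b_{m,0}$ with \<open>m < n\<close>. In terms of generating functions this says
  $H = N + D H$ with the numerator \<open>N\<close> and \<open>D\<close> one minus the denominator of the formula.
\<close>

unbundle fps_syntax

section \<open>Interior points\<close>

lemma unit_cell_eq_iff: "unit_cell i j = unit_cell i' j' \<longleftrightarrow> i = i' \<and> j = j'"
proof -
  have "{real i..real i + 1} \<noteq> {}" "{real j..real j + 1} \<noteq> {}" by auto
  then show ?thesis by (auto simp: unit_cell_def times_eq_iff Icc_eq_Icc)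
qed

text \<open>Distinct intervals \<open>[i, i + 1]\<close> overlap in at most an end point, so only the intervals that
  end or start at \<open>x\<close> can make \<open>I\<close> have two elements.\<close>

lemma unit_intervals_containing:
  fixes x :: real
  defines "I \<equiv> {i::nat. real i \<le> x \<and> x \<le> real i + 1}"
  shows "finite I" and "card I \<le> 2" and "card I = 2 \<Longrightarrow> \<exists>a\<ge>1. x = real a \<and> I = {a - 1, a}"
proof -
  have sub: "I \<subseteq> {nat \<lfloor>x\<rfloor>, nat \<lfloor>x\<rfloor> - 1}"
  proof
    fix i assume "i \<in> I"
    then have "int i \<le> \<lfloor>x\<rfloor>" "\<lfloor>x\<rfloor> \<le> int i + 1"
      unfolding I_def by (auto simp: le_floor_iff) linarith
    then show "i \<in> {nat \<lfloor>x\<rfloor>, nat \<lfloor>x\<rfloor> - 1}" by auto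
  qed
  then show fin: "finite I" by (rule finite_subset) simp
  have "card I \<le> card {nat \<lfloor>x\<rfloor>, nat \<lfloor>x\<rfloor> - 1}" by (rule card_mono[OF _ sub]) simp
  also have "\<dots> \<le> 2" by (simp add: card_insert_if)
  finally show "card I \<le> 2" .
  assume "card I = 2"
  then obtain i i' where I: "I = {i, i'}" and "i < i'"
    by (auto simp: card_2_iff) (metis insert_commute linorder_neqE_nat)
  have "real i' \<le> x" "x \<le> real i + 1" using I unfolding I_def by blast+
  with \<open>i < i'\<close> have "i = i' - 1" "1 \<le> i'" "x = real i'" by linarith+
  with I show "\<exists>a\<ge>1. x = real a \<and> I = {a - 1, a}" by blast
qed

text \<open>The four cells around a point must be all the products of two horizontal and two vertical
  unit intervals, since a point lies in at most two intervals of each kind. Hence the point is a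
  lattice point \<open>(a, b)\<close> between the columns \<open>a - 1\<close> and \<open>a\<close>, which both reach above height
  \<open>b\<close>.\<close>

lemma interior_points_eq:
  "interior_points w = (\<lambda>(a, b). (real a, real b)) `
     (SIGMA a:{1..<length w}. {1..<min (w ! (a - 1)) (w ! a)})" (is "_ = ?f ` ?L")
proof -
  define J where "J x = {i::nat. real i \<le> x \<and> x \<le> real i + 1}" for x
  define S where "S x y = {(i, j). i \<in> J x \<and> j \<in> J y \<and> i < length w \<and> j < w ! i}" for x y
  have cells: "card {c \<in> polyomino w. (x, y) \<in> c} = card (S x y)" for x y
  proof -
    have "{c \<in> polyomino w. (x, y) \<in> c} = (\<lambda>(i, j). unit_cell i j) ` S x y"
      by (force simp: polyomino_def S_def J_def unit_cell_def)
    moreover have "inj_on (\<lambda>(i, j). unit_cell i j) (S x y)"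
      by (auto simp: inj_on_def unit_cell_eq_iff)
    ultimately show ?thesis by (simp add: card_image)
  qed
  have J_real: "J (real a) = {a - 1, a}" if "a \<ge> 1" for a
  proof -
    have "real i \<le> real a \<and> real a \<le> real i + 1 \<longleftrightarrow> i = a - 1 \<or> i = a" for i
      using that by linarith
    then show ?thesis by (auto simp: J_def)
  qed
  have S4: "card (S x y) = 4 \<longleftrightarrow> (x, y) \<in> ?f ` ?L" for x y
  proof
    assume 4: "card (S x y) = 4"
    note X = unit_intervals_containing[of x, folded J_def]
    note Y = unit_intervals_containing[of y, folded J_def]
    have sub: "S x y \<subseteq> J x \<times> J y" by (auto simp: S_def)
    have "4 \<le> card (J x) * card (J y)"
      using card_mono[OF _ sub] X(1) Y(1) 4 by (simp add: card_cartesian_product)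
    moreover have "card (J x) * card (J y) \<le> card (J x) * 2" "card (J x) * card (J y) \<le> 2 * card (J y)"
      using X(2) Y(2) by simp_all
    ultimately have c: "card (J x) = 2" "card (J y) = 2" using X(2) Y(2) by linarith+
    have S: "S x y = J x \<times> J y"
      using sub 4 c X(1) Y(1) by (intro card_subset_eq) (auto simp: card_cartesian_product)
    obtain a b where ab: "a \<ge> 1" "x = real a" "J x = {a - 1, a}" "b \<ge> 1" "y = real b" "J y = {b - 1, b}"
      using X(3)[OF c(1)] Y(3)[OF c(2)] by blast
    have "(a - 1, b) \<in> S x y" "(a, b) \<in> S x y" unfolding S using ab by auto
    then have "(a, b) \<in> ?L" using ab by (auto simp: S_def)
    then show "(x, y) \<in> ?f ` ?L" using ab by force
  next
    assume "(x, y) \<in> ?f ` ?L"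
    then obtain a b where ab: "x = real a" "y = real b" "a \<ge> 1" "a < length w" "b \<ge> 1"
      "b < w ! (a - 1)" "b < w ! a" by auto
    then have "S x y = {a - 1, a} \<times> {b - 1, b}" by (auto simp: S_def J_real)
    moreover have "card {a - 1, a} = 2" "card {b - 1, b} = 2" using ab by (auto simp: card_insert_if)
    ultimately show "card (S x y) = 4" by (simp only: card_cartesian_product)
  qed
  have "p \<in> interior_points w \<longleftrightarrow> p \<in> ?f ` ?L" for p
    by (cases p) (simp only: interior_points_def mem_Collect_eq cells S4)
  then show ?thesis by blast
qed

lemma inter_eq_sum: "inter w = (\<Sum>a = 1..<length w. min (w ! (a - 1)) (w ! a) - 1)"
proof -
  have "inj_on (\<lambda>(a, b). (real a, real b)) A" for A by (auto simp: inj_on_def)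
  then show ?thesis
    unfolding inter_def interior_points_eq by (subst card_image) (simp_all add: card_SigmaI)
qed

lemma inter_snoc:
  assumes "w \<noteq> []"
  shows "inter (w @ [a]) = inter w + (min (last w) a - 1)"
proof -
  obtain n where n: "length w = Suc n" using assms by (cases w) auto
  have "(\<Sum>i = 1..<Suc n. min ((w @ [a]) ! (i - 1)) ((w @ [a]) ! i) - 1) =
    (\<Sum>i = 1..<Suc n. min (w ! (i - 1)) (w ! i) - 1)"
    using n by (intro sum.cong) (auto simp: nth_append)
  then show ?thesis using n assms
    by (simp add: inter_eq_sum nth_append last_conv_nth)
qed

section \<open>Motzkin words by their last letter\<close>

lemma motzkin_words_0: "motzkin_words 0 = {}"
  by (simp add: motzkin_words_def)

lemma motzkin_words_1: "motzkin_words 1 = {[1]}"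
  by (auto simp: motzkin_words_def length_Suc_conv)

lemma motzkin_words_nonempty: "w \<in> motzkin_words n \<Longrightarrow> w \<noteq> []"
  by (auto simp: motzkin_words_def)

lemma motzkin_words_last_pos: "w \<in> motzkin_words n \<Longrightarrow> last w \<ge> 1"
  unfolding motzkin_words_def mem_Collect_eq by (subst last_conv_nth) auto

lemma motzkin_words_Suc:
  assumes "n \<ge> 1"
  shows "motzkin_words (Suc n) = (\<lambda>(w, a). w @ [a]) `
    (SIGMA w:motzkin_words n. insert (last w + 1) {1..<last w})" (is "?A = ?g ` ?B")
proof -
  have step: "w @ [a] \<in> ?A \<longleftrightarrow> w \<in> motzkin_words n \<and> a \<in> insert (last w + 1) {1..<last w}" for w a
  proof (cases "length w = n")
    case True
    with assms have "w \<noteq> []" by auto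
    with True have l: "last w = w ! (n - 1)" by (simp add: last_conv_nth)
    have split: "(\<forall>k<Suc n. P k) \<longleftrightarrow> (\<forall>k<n. P k) \<and> P n" for P
      by (auto simp: less_Suc_eq)
    have split': "(\<forall>k\<in>{1..<Suc n}. P k) \<longleftrightarrow> (\<forall>k\<in>{1..<n}. P k) \<and> P n" for P
      using assms by (auto simp: less_Suc_eq)
    have "w @ [a] \<in> ?A \<longleftrightarrow> (\<forall>k<n. w ! k \<ge> 1) \<and> a \<ge> 1 \<and> w ! 0 = 1 \<and>
        (\<forall>k\<in>{1..<n}. w ! k \<le> w ! (k - 1) + 1 \<and> w ! (k - 1) \<noteq> w ! k) \<and>
        a \<le> last w + 1 \<and> last w \<noteq> a"
      unfolding motzkin_words_def mem_Collect_eq split split'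
      using True assms l by (auto simp: nth_append)
    then show ?thesis using True assms
      unfolding motzkin_words_def mem_Collect_eq by auto
  next
    case False
    then show ?thesis by (auto simp: motzkin_words_def)
  qed
  show ?thesis
  proof (intro equalityI subsetI)
    fix v assume v: "v \<in> ?A"
    then have "v = butlast v @ [last v]" using motzkin_words_nonempty by simp
    moreover from this v have "(butlast v, last v) \<in> ?B" using step by (metis mem_Sigma_iff)
    ultimately show "v \<in> ?g ` ?B" by (metis (no_types, lifting) case_prod_conv image_eqI)
  next
    fix v assume "v \<in> ?g ` ?B"
    then show "v \<in> ?A" using step by auto
  qed
qed

lemma finite_motzkin_words: "finite (motzkin_words n)"
proof (induction n)
  case (Suc n)
  then show ?case
    by (cases "n = 0") (auto simp: motzkin_words_1[simplified] motzkin_words_Suc)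
qed (simp add: motzkin_words_0)

lemma sum_motzkin_words_Suc:
  assumes "n \<ge> 1"
  shows "(\<Sum>v\<in>motzkin_words (Suc n). f v) =
    (\<Sum>w\<in>motzkin_words n. \<Sum>a\<in>insert (last w + 1) {1..<last w}. f (w @ [a]))"
proof -
  have inj: "inj_on (\<lambda>(w, a). w @ [a]) B" for B by (auto simp: inj_on_def)
  show ?thesis
    unfolding motzkin_words_Suc[OF assms] sum.reindex[OF inj]
    by (subst sum.Sigma) (auto simp: finite_motzkin_words case_prod_unfold)
qed

section \<open>The recurrence\<close>

lemma one_minus_power_inverse:
  assumes "m \<ge> 1"
  shows "(1 - fps_X ^ m) * (1 / (1 - fps_X ^ m :: rat fps)) = 1"
proof -
  have "(1 - fps_X ^ m :: rat fps) $ 0 \<noteq> 0" using assms by simp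
  then show ?thesis by (simp add: fps_divide_unit inverse_mult_eq_1')
qed

text \<open>The exponent of the catalytic value $q^j$ is \<open>last w - 1\<close> rather than \<open>last w\<close>, which normalises the value at the
  word \<open>[1]\<close> to \<open>1\<close> for every \<open>j\<close>; the recurrence then has no stray powers of \<open>q\<close>.\<close>

definition last_letter_sum :: "nat \<Rightarrow> nat \<Rightarrow> rat fps" where
  "last_letter_sum n j = (\<Sum>w\<in>motzkin_words n. fps_X ^ (inter w + j * (last w - 1)))"

text \<open>The contribution of all letters that may follow the last letter \<open>k\<close>: the ascent to \<open>k + 1\<close>
  adds \<open>k - 1\<close> interior points, and a descent to \<open>a\<close> adds \<open>a - 1\<close>, so that the descents form a
  geometric sum with ratio $q^{j+1}$.\<close>

lemma sum_next_letters:
  fixes q :: "rat fps"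
  defines "q \<equiv> fps_X"
  assumes "k \<ge> 1"
  shows "(\<Sum>a\<in>insert (k + 1) {1..<k}. q ^ ((min k a - 1) + j * (a - 1))) =
    1 / (1 - q ^ Suc j) + (q ^ j - 1 / (1 - q ^ Suc j)) * q ^ (Suc j * (k - 1))"
proof -
  obtain m where k: "k = Suc m" using assms by (cases k) auto
  let ?z = "q ^ Suc j" and ?c = "1 / (1 - q ^ Suc j)"
  have inv: "(1 - ?z) * ?c = 1" unfolding q_def by (rule one_minus_power_inverse) simp
  have "(\<Sum>a = 1..<k. q ^ ((min k a - 1) + j * (a - 1))) = (\<Sum>a = 1..<Suc m. ?z ^ (a - 1))"
    unfolding k
  proof (intro sum.cong refl)
    fix a assume "a \<in> {1..<Suc m}"
    then have "min (Suc m) a = a" by auto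
    then show "q ^ ((min (Suc m) a - 1) + j * (a - 1)) = ?z ^ (a - 1)"
      by (simp only: power_mult[symmetric] mult_Suc)
  qed
  also have "\<dots> = (\<Sum>i<m. ?z ^ i)"
    by (simp only: One_nat_def sum.shift_bounds_Suc_ivl diff_Suc_Suc diff_zero atLeast0LessThan)
  also have "\<dots> = (1 - ?z) * ?c * (\<Sum>i<m. ?z ^ i)" by (simp only: inv mult_1)
  also have "\<dots> = ?c * ((1 - ?z) * (\<Sum>i<m. ?z ^ i))" by (simp only: mult_ac)
  also have "\<dots> = ?c * (1 - ?z ^ m)" by (simp only: one_diff_power_eq)
  finally have desc: "(\<Sum>a = 1..<k. q ^ ((min k a - 1) + j * (a - 1))) = ?c * (1 - ?z ^ m)" .
  have "(\<Sum>a\<in>insert (k + 1) {1..<k}. q ^ ((min k a - 1) + j * (a - 1))) =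
     q ^ (m + j * Suc m) + ?c * (1 - ?z ^ m)"
    unfolding desc[symmetric] by (subst sum.insert) (auto simp: k)
  also have "q ^ (m + j * Suc m) = q ^ j * ?z ^ m"
    by (simp add: power_mult[symmetric] power_add[symmetric] algebra_simps)
  also have "?z ^ m = q ^ (Suc j * (k - 1))" by (simp only: k power_mult diff_Suc_1)
  finally show ?thesis
    by (simp only: left_diff_distrib right_diff_distrib mult_1_right add_diff_eq add.commute)
qed

lemma last_letter_sum_0: "last_letter_sum 0 j = 0"
  by (simp add: last_letter_sum_def motzkin_words_0)

lemma last_letter_sum_Suc:
  fixes q :: "rat fps"
  defines "q \<equiv> fps_X"
  shows "last_letter_sum (Suc n) j = (if n = 0 then 1 else 0)
    + 1 / (1 - q ^ Suc j) * last_letter_sum n 0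
    + (q ^ j - 1 / (1 - q ^ Suc j)) * last_letter_sum n (Suc j)"
proof (cases "n = 0")
  case True
  then show ?thesis
    using motzkin_words_1 by (simp add: last_letter_sum_def motzkin_words_0 inter_eq_sum)
next
  case False
  let ?c = "1 / (1 - q ^ Suc j)"
  have distribute: "x * (c + r * y) = c * (x * 1) + r * (x * y)" for x y c r :: "rat fps"
    by (simp add: algebra_simps)
  have "last_letter_sum (Suc n) j = (\<Sum>w\<in>motzkin_words n. \<Sum>a\<in>insert (last w + 1) {1..<last w}.
      q ^ (inter (w @ [a]) + j * (a - 1)))"
    using False by (simp only: last_letter_sum_def q_def sum_motzkin_words_Suc last_snoc)
  also have "\<dots> = (\<Sum>w\<in>motzkin_words n. q ^ inter w *
      (\<Sum>a\<in>insert (last w + 1) {1..<last w}. q ^ ((min (last w) a - 1) + j * (a - 1))))"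
    unfolding sum_distrib_left
    by (intro sum.cong refl)
      (simp add: inter_snoc[OF motzkin_words_nonempty] power_add mult.assoc)
  also have "\<dots> = (\<Sum>w\<in>motzkin_words n. q ^ inter w *
      (?c + (q ^ j - ?c) * q ^ (Suc j * (last w - 1))))"
    unfolding q_def
    by (intro sum.cong refl) (simp only: sum_next_letters motzkin_words_last_pos)
  also have "\<dots> = (\<Sum>w\<in>motzkin_words n. ?c * q ^ (inter w + 0 * (last w - 1)) +
      (q ^ j - ?c) * q ^ (inter w + Suc j * (last w - 1)))"
    by (intro sum.cong refl) (simp only: power_add mult_0 power_0 distribute)
  also have "\<dots> = ?c * last_letter_sum n 0 + (q ^ j - ?c) * last_letter_sum n (Suc j)"
    by (simp only: last_letter_sum_def q_def sum.distrib sum_distrib_left)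
  finally show ?thesis using False by simp
qed

text \<open>Iterating \<open>n\<close> times reaches \<open>b 0 (j + n) = 0\<close>, so nothing remains. After \<open>m - 1\<close> shifts of
  the second index the accumulated factor is the product of \<open>d (j + 1), \<dots>, d (j + m - 1)\<close>.\<close>

lemma unroll_shift_recurrence:
  fixes b :: "nat \<Rightarrow> nat \<Rightarrow> 'a::comm_ring_1"
  assumes b0: "\<And>j. b 0 j = 0"
    and bSuc: "\<And>n j. b (Suc n) j =
      (if n = 0 then 1 else 0) + c (Suc j) * b n 0 + d (Suc j) * b n (Suc j)"
  shows "b n j = (\<Sum>m = 1..n. (\<Prod>i = 1..<m. d (j + i)) *
      ((if m = n then 1 else 0) + c (j + m) * b (n - m) 0))"
proof (induction n arbitrary: j)
  case 0
  then show ?case by (simp add: b0)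
next
  case (Suc n)
  let ?t = "\<lambda>n j m. (\<Prod>i = 1..<m. d (j + i)) *
      ((if m = n then 1 else 0) + c (j + m) * b (n - m) 0)"
  have shift: "d (Suc j) * ?t n (Suc j) m = ?t (Suc n) j (Suc m)" if "m \<ge> 1" for m
  proof -
    have "(\<Prod>i = 1..<Suc m. d (j + i)) = d (Suc j) * (\<Prod>i = Suc 1..<Suc m. d (j + i))"
      using that by (subst prod.atLeast_Suc_lessThan) auto
    also have "(\<Prod>i = Suc 1..<Suc m. d (j + i)) = (\<Prod>i = 1..<m. d (Suc j + i))"
      by (subst prod.shift_bounds_Suc_ivl) simp
    finally show ?thesis by (simp add: mult.assoc)
  qed
  have "(\<Sum>m = 1..Suc n. ?t (Suc n) j m) = ?t (Suc n) j 1 + (\<Sum>m = Suc 1..Suc n. ?t (Suc n) j m)"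
    by (subst sum.atLeast_Suc_atMost) auto
  also have "(\<Sum>m = Suc 1..Suc n. ?t (Suc n) j m) = (\<Sum>m = 1..n. ?t (Suc n) j (Suc m))"
    by (subst sum.shift_bounds_cl_Suc_ivl) simp
  also have "\<dots> = (\<Sum>m = 1..n. d (Suc j) * ?t n (Suc j) m)"
    by (intro sum.cong refl) (simp only: shift atLeastAtMost_iff)
  also have "\<dots> = d (Suc j) * b n (Suc j)"
    by (simp only: Suc[of "Suc j"] sum_distrib_left)
  finally show ?case by (simp add: bSuc[of n j])
qed

section \<open>The generating function\<close>

lemma H_nth: "H $ n = last_letter_sum n 0"
  by (cases n) (simp_all add: H_def last_letter_sum_def motzkin_words_0)

text \<open>Coefficients of the outer series lie in a ring that is not a field, so division by \<open>f\<close>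
  relies on the constant term of \<open>f\<close> being \<open>1\<close>.\<close>

lemma fps_eq_divide_of_nth_0_eq_1:
  fixes f g h :: "'a::field fps fps"
  assumes "f $ 0 = 1" and "h * f = g"
  shows "h = g / f"
proof -
  have "f * inverse f = 1"
    using assms(1) fps_right_inverse[of f 1] by (simp add: fps_inverse_def[of f])
  moreover have "g / f = g * inverse f" using assms(1) by (intro fps_divide_unit) simp
  ultimately show ?thesis using assms(2) by (metis mult.assoc mult.right_neutral)
qed

theorem corollary6p2:
  fixes q :: "rat fps"
  defines "q \<equiv> fps_X"
  shows "H =
    Abs_fps (\<lambda>j. if j \<ge> 1 then \<Prod>i=1..<j. q ^ (i - 1) - 1 / (1 - q ^ i) else 0)
    / (1 - Abs_fps (\<lambda>j. if j \<ge> 1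
             then 1 / (1 - q ^ j) * (\<Prod>i=1..<j. q ^ (i - 1) - 1 / (1 - q ^ i)) else 0))"
proof -
  define c where "c j = 1 / (1 - q ^ j)" for j
  define d where "d i = q ^ (i - 1) - 1 / (1 - q ^ i)" for i
  define p where "p j = (\<Prod>i = 1..<j. d i)" for j
  define N where "N = Abs_fps (\<lambda>j. if j \<ge> 1 then p j else 0)"
  define D where "D = Abs_fps (\<lambda>j. if j \<ge> 1 then c j * p j else 0)"
  have rec: "last_letter_sum n 0 =
      (\<Sum>m = 1..n. p m * ((if m = n then 1 else 0) + c m * last_letter_sum (n - m) 0))" for n
    using unroll_shift_recurrence[of last_letter_sum c d n 0]
    by (simp add: last_letter_sum_0 last_letter_sum_Suc c_def d_def p_def q_def)
  have "H = N + D * H"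
  proof (rule fps_ext)
    fix n
    have "H $ n = (\<Sum>m = 1..n. if m = n then p m else 0) +
        (\<Sum>m = 1..n. c m * p m * last_letter_sum (n - m) 0)"
      unfolding H_nth rec[of n] sum.distrib[symmetric]
      by (intro sum.cong refl) (simp add: algebra_simps)
    also have "(\<Sum>m = 1..n. if m = n then p m else 0) = N $ n"
      by (simp add: N_def)
    also have "(\<Sum>m = 1..n. c m * p m * last_letter_sum (n - m) 0) = (\<Sum>m = 1..n. D $ m * H $ (n - m))"
      by (intro sum.cong refl) (simp add: D_def H_nth)
    also have "\<dots> = (D * H) $ n"
      unfolding fps_mult_nth by (intro sum.mono_neutral_left) (auto simp: D_def)
    finally show "H $ n = (N + D * H) $ n" by simp
  qed
  then have "H * (1 - D) = N" by (simp add: algebra_simps)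
  moreover have "(1 - D) $ 0 = 1" by (simp add: D_def)
  ultimately have "H = N / (1 - D)" by (rule fps_eq_divide_of_nth_0_eq_1[rotated])
  then show ?thesis by (simp only: N_def D_def p_def c_def d_def)
qed

end
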